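(* For every integer $n\ge 2$, $$ SOME(n)\ge SOME(n-2). $$
   Context: A partition of a positive integer $n$ is a non-increasing finite sequence of positive integers (its parts) with sum $n$. $SOME(n)$ is the sum of all odd parts in all partitions of $n$ minus the sum of all even parts in all partitions of $n$ (parts counted with multiplicity), with $SOME(0)=0$. *)

theory Defs
  imports Main
begin

definition int_partitions :: "nat \<Rightarrow> nat list set" where
  "int_partitions n =
    {xs. sorted_wrt (\<ge>) xs \<and> (\<forall>x\<in>set xs. 0 < x) \<and> sum_list xs = n}"

(* SOME(n), "sum of odd minus even" parts; \<open>SOME\<close> itself is reserved syntax. *)
definition some_diff :: "nat \<Rightarrow> int" where
  "some_diff n =
    (\<Sum>xs\<in>int_partitions n. \<Sum>x\<leftarrow>filter odd xs. int x) -
    (\<Sum>xs\<in>int_partitions n. \<Sum>x\<leftarrow>filter even xs. int x)"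

(* The outer sums in some_diff are therefore genuine finite sums. *)
lemma finite_int_partitions: "finite (int_partitions n)"
proof (rule finite_subset)
  have len: "length xs \<le> sum_list xs" if "\<forall>x\<in>set xs. 0 < x" for xs :: "nat list"
    using that by (induction xs) auto
  show "int_partitions n \<subseteq> {xs. set xs \<subseteq> {..n} \<and> length xs \<le> n}"
    using len member_le_sum_list by (fastforce simp: int_partitions_def)
  show "finite {xs :: nat list. set xs \<subseteq> {..n} \<and> length xs \<le> n}"
    by (rule finite_lists_length_le) simp
qed

(* The convention SOME(0) = 0: the empty list is the only element of int_partitions 0. *)
lemma some_diff_0: "some_diff 0 = 0"
proof -
  have "xs = []" if "xs \<in> int_partitions 0" for xs
    using that by (cases xs) (auto simp: int_partitions_def)
  hence "int_partitions 0 = {[]}"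
    by (auto simp: int_partitions_def)
  thus ?thesis
    by (simp add: some_diff_def)
qed

end

theory Submission
  imports Defs "HOL-Computational_Algebra.Formal_Power_Series"
begin

text \<open>
  With \<open>\<psi>(q) = \<Prod>\<^sub>k (1 - q\<^bsup>2k\<^esup>) / (1 - q\<^bsup>2k-1\<^esup>)\<close> the partition generating function is
  \<open>\<psi>(q) \<Prod>\<^sub>k (1 - q\<^bsup>2k\<^esup>)\<^bsup>-2\<^esup>\<close>. Weighting each part \<open>k\<close> by \<open>k\<close> if it
  is odd and by \<open>-k\<close> if it is even multiplies this series by
  \<open>\<Sum>\<^sub>k (-1)\<^bsup>k-1\<^esup> k q\<^sup>k / (1 - q\<^sup>k)\<close>, which is the logarithmic derivative \<open>q \<psi>' / \<psi>\<close>, so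
  \<open>\<Sum>\<^sub>n SOME(n) q\<^sup>n = q \<psi>'(q) \<Prod>\<^sub>k (1 - q\<^bsup>2k\<^esup>)\<^bsup>-2\<^esup>\<close>.
  By Gauss, \<open>\<psi>(q) = \<Sum>\<^sub>j q\<^bsup>j(j+1)/2\<^esup>\<close>, so \<open>q \<psi>'\<close> has nonnegative coefficients, and multiplying
  by \<open>1 - q\<^sup>2\<close> merely cancels one factor \<open>(1 - q\<^sup>2)\<^bsup>-1\<^esup>\<close>. Restricting to parts of size at
  most \<open>2n\<close> makes all products finite; Gauss' identity is then replaced by a finite
  identity of Shanks, which determines \<open>\<psi>\<close> up to \<open>q\<^bsup>2n\<^esup>\<close>.
\<close>

section \<open>A finite form of Gauss' identity\<close>

text \<open>Induction on \<open>n\<close>: after multiplication by 1 - \<open>q ^ (2*n+1)\<close>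
  the increment of the left side telescopes in \<open>s\<close>, and what remains are the two new
  triangular exponents, for j = 2n and j = 2n+1. Here \<open>r k\<close> stands for a quotient,
  specified by its product equation so that no division occurs.\<close>

lemma shanks_identity:
  fixes q :: "'a::idom" and r :: "nat \<Rightarrow> 'a"
  assumes r: "\<And>k. (1 - q ^ (2*k+1)) * r k = 1 - q ^ (2*k+2)"
    and nz: "\<And>k. 1 - q ^ (2*k+1) \<noteq> 0"
  shows "(\<Sum>s<n. prod r {s..<n} * q ^ (s*(2*n+1))) = (\<Sum>j<2*n. q ^ (j*(j+1) div 2))"
proof (induction n)
  case 0
  show ?case by simp
next
  case (Suc n)
  define d where "d = 1 - q ^ (2*n+1)"
  \<comment> \<open>The telescoping certificate. Its factor \<open>1 - q ^ (2*s)\<close> vanishes at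
    \<open>s = 0\<close>, so only the upper end \<open>t n\<close> survives.\<close>
  define t where "t s = prod r {s..<n} * (1 - q ^ (2*s)) * q ^ (s*(2*n+1))" for s
  let ?S = "\<lambda>n. \<Sum>s<n. prod r {s..<n} * q ^ (s*(2*n+1))"
  have telescope: "d * (prod r {s..<Suc n} * q ^ (s*(2*Suc n+1)) - prod r {s..<n} * q ^ (s*(2*n+1)))
      = t (Suc s) - t s" if "s < n" for s
  proof -
    define p a b Q where "p = prod r {Suc s..<n}" and "a = q ^ (2*s)" and "b = q ^ (2*n)"
      and "Q = q ^ (s*(2*n+1))"
    have p: "prod r {s..<n} = r s * p" "prod r {s..<Suc n} = r s * p * r n"
      using that by (simp_all add: p_def prod.atLeast_Suc_lessThan)
    have Q: "q ^ (s*(2*Suc n+1)) = a * Q"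
      by (simp add: a_def Q_def power_add[symmetric] algebra_simps)
    have d: "d = 1 - b * q"
      by (simp add: d_def b_def)
    have dr: "d * r n = 1 - b * q * q"
      unfolding d_def r by (simp add: b_def power_add power2_eq_square mult_ac)
    have "d * (r s * p * r n * (a * Q)) = (d * r n) * (r s * p * a * Q)"
      by (simp only: mult_ac)
    then have 1: "d * (r s * p * r n * (a * Q)) = (1 - b * q * q) * (r s * p * a * Q)"
      unfolding dr .
    have ts: "t s = r s * p * (1 - a) * Q"
      by (simp only: t_def p a_def Q_def)
    have "t (Suc s) = p * (1 - q ^ (2*s+2)) * (Q * (b * q))"
      by (simp add: t_def p_def Q_def b_def power_add mult_ac)
    also have "1 - q ^ (2*s+2) = (1 - a * q) * r s"
      unfolding r[symmetric] by (simp add: a_def mult_ac)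
    finally have tS: "t (Suc s) = p * ((1 - a * q) * r s) * (Q * (b * q))" .
    show ?thesis
      unfolding p Q Q_def[symmetric] right_diff_distrib[of d] 1 ts tS
      unfolding d by (simp add: algebra_simps)
  qed
  have "d * (?S (Suc n) - ?S n)
      = (\<Sum>s<n. d * (prod r {s..<Suc n} * q ^ (s*(2*Suc n+1)) - prod r {s..<n} * q ^ (s*(2*n+1))))
        + (d * r n) * q ^ (n*(2*Suc n+1))"
    by (simp add: sum_subtractf sum_distrib_left algebra_simps)
  also have "\<dots> = (\<Sum>s<n. t (Suc s) - t s) + (1 - q ^ (2*n+2)) * q ^ (n*(2*Suc n+1))"
    unfolding d_def r using telescope[unfolded d_def] by simp
  also have "(\<Sum>s<n. t (Suc s) - t s) = (1 - q ^ (2*n)) * q ^ (n*(2*n+1))"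
    by (simp add: sum_lessThan_telescope) (simp add: t_def)
  \<comment> \<open>With b = \<open>q ^ (2*n)\<close> this is a difference of squares: (1 - b) + b
    (1 - b q^2) = (1 - bq)(1 + bq).\<close>
  also have "\<dots> + (1 - q ^ (2*n+2)) * q ^ (n*(2*Suc n+1))
      = d * (q ^ (n*(2*n+1)) + q ^ (n*(2*n+1) + (2*n+1)))"
  proof -
    have e: "n*(2*Suc n+1) = n*(2*n+1) + 2*n" by simp
    show ?thesis
      unfolding e d_def power_add by (simp add: algebra_simps power_mult power2_eq_square)
  qed
  finally have "?S (Suc n) - ?S n = q ^ (n*(2*n+1)) + q ^ (n*(2*n+1) + (2*n+1))"
    using nz[of n] by (simp add: d_def)
  moreover have "(2*n)*(2*n+1) div 2 = n*(2*n+1)"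
    by simp
  moreover have "(2*n+1)*(2*n+1+1) div 2 = n*(2*n+1) + (2*n+1)"
  proof -
    have "(2*n+1)*(2*n+1+1) = 2 * (n*(2*n+1) + (2*n+1))" by (simp add: algebra_simps)
    thus ?thesis by (simp only: nonzero_mult_div_cancel_left)
  qed
  moreover have "2 * Suc n = Suc (2*n+1)" by simp
  ultimately have "(\<Sum>j<2*Suc n. q ^ (j*(j+1) div 2))
      = (\<Sum>j<2*n. q ^ (j*(j+1) div 2)) + (?S (Suc n) - ?S n)"
    by (simp only: sum.lessThan_Suc Suc_eq_plus1 [symmetric] add.assoc)
  then show ?case
    unfolding Suc.IH[symmetric] by (simp only: add_diff_cancel_left' add_diff_eq)
qed

section \<open>Power series with nonnegative coefficients\<close>

definition fps_geom :: "nat \<Rightarrow> int fps" where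
  "fps_geom k = Abs_fps (\<lambda>n. if k dvd n then 1 else 0)"

lemma fps_geom_inverse:
  assumes "k > 0"
  shows "(1 - fps_X ^ k) * fps_geom k = 1"
proof (rule fps_ext)
  fix n
  show "fps_nth ((1 - fps_X ^ k) * fps_geom k) n = fps_nth 1 n"
    using assms
    by (auto simp: fps_geom_def left_diff_distrib fps_X_power_mult_nth dvd_minus_self dest: dvd_imp_le)
qed

text \<open>Solves the recurrences that arise from removing one part of size
  \<open>k\<close>.\<close>

lemma fps_geom_unique:
  assumes "k > 0" "F = G + fps_X ^ k * F"
  shows "F = G * fps_geom k"
proof -
  have "F * (1 - fps_X ^ k) = G"
    using assms(2) by (simp add: algebra_simps)
  then have "G * fps_geom k = F * ((1 - fps_X ^ k) * fps_geom k)"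
    by (simp add: mult.assoc)
  then show ?thesis
    by (simp add: fps_geom_inverse[OF assms(1)])
qed

text \<open>A degree bound is built in because the truncated product can have negative coefficients
  further out: \<open>psi 2\<close> has -1 at q^5. Products respect the bound, since degree m only
  involves degrees up to m.\<close>

definition nonneg_upto :: "nat \<Rightarrow> int fps \<Rightarrow> bool" where
  "nonneg_upto n F \<longleftrightarrow> (\<forall>m\<le>n. 0 \<le> fps_nth F m)"

lemma nonneg_upto_1: "nonneg_upto n 1"
  by (simp add: nonneg_upto_def)

lemma nonneg_upto_fps_geom: "nonneg_upto n (fps_geom k)"
  by (simp add: nonneg_upto_def fps_geom_def)

lemma nonneg_upto_mult:
  assumes "nonneg_upto n F" "nonneg_upto n G"
  shows "nonneg_upto n (F * G)"
  using assms by (auto simp: nonneg_upto_def fps_mult_nth intro!: sum_nonneg)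

lemma nonneg_upto_prod:
  assumes "\<And>k. k \<in> A \<Longrightarrow> nonneg_upto n (F k)"
  shows "nonneg_upto n (prod F A)"
  using assms by (induction A rule: infinite_finite_induct) (auto intro: nonneg_upto_1 nonneg_upto_mult)

section \<open>The truncated product \<open>\<psi>\<close>\<close>

definition psi_factor :: "nat \<Rightarrow> int fps" where
  "psi_factor k = (1 - fps_X ^ (2*k+2)) * fps_geom (2*k+1)"

definition psi :: "nat \<Rightarrow> int fps" where
  "psi n = prod psi_factor {0..<n}"

text \<open>In \<open>shanks_identity\<close> the summand \<open>s = 0\<close> is
  \<open>psi n\<close>, and all others are divisible by q^(2n+1). Up to degree 2n,
  \<open>psi n\<close> thus agrees with a sum of powers of q.\<close>

lemma nonneg_upto_psi:
  assumes "n > 0"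
  shows "nonneg_upto (2*n) (psi n)"
proof -
  let ?f = "\<lambda>s. prod psi_factor {s..<n} * fps_X ^ (s*(2*n+1))"
  have factor: "(1 - fps_X ^ (2*k+1)) * psi_factor k = 1 - fps_X ^ (2*k+2)" for k
  proof -
    have "(1 - fps_X ^ (2*k+1)) * psi_factor k
        = (1 - fps_X ^ (2*k+2)) * ((1 - fps_X ^ (2*k+1)) * fps_geom (2*k+1))"
      unfolding psi_factor_def by (simp only: mult.left_commute)
    also have "\<dots> = 1 - fps_X ^ (2*k+2)"
      by (subst fps_geom_inverse) simp_all
    finally show ?thesis .
  qed
  have nz: "1 - fps_X ^ (2*k+1) \<noteq> (0 :: int fps)" for k
    using fps_geom_inverse[of "2*k+1"] by auto
  have "sum ?f {..<n} = psi n + (\<Sum>s=1..<n. ?f s)"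
    using assms by (simp add: lessThan_atLeast0 sum.atLeast_Suc_lessThan psi_def)
  then have eq: "psi n + (\<Sum>s=1..<n. ?f s) = (\<Sum>j<2*n. fps_X ^ (j*(j+1) div 2))"
    using shanks_identity[OF factor nz] by simp
  show ?thesis
    unfolding nonneg_upto_def
  proof (intro allI impI)
    fix m assume m: "m \<le> 2*n"
    have "fps_nth (?f s) m = 0" if "s \<in> {1..<n}" for s
    proof -
      have "1 * (2*n+1) \<le> s*(2*n+1)"
        using that by (intro mult_right_mono) auto
      then show ?thesis
        using m by (simp add: fps_X_power_mult_right_nth)
    qed
    then have "fps_nth (psi n) m = fps_nth (\<Sum>j<2*n. fps_X ^ (j*(j+1) div 2)) m"
      unfolding eq[symmetric] by (simp add: fps_sum_nth)
    also have "\<dots> \<ge> 0"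
      by (simp add: fps_sum_nth fps_X_power_nth sum_nonneg)
    finally show "0 \<le> fps_nth (psi n) m" .
  qed
qed

lemma fps_X_deriv_one_minus_X_power:
  "fps_X * fps_deriv (1 - fps_X ^ k) = (- of_nat k * fps_X ^ k :: int fps)"
proof (induction k)
  case 0
  show ?case by simp
next
  case (Suc k)
  have "fps_X * fps_deriv (1 - fps_X ^ Suc k)
      = fps_X * (fps_X * fps_deriv (1 - fps_X ^ k)) - (fps_X * fps_X ^ k :: int fps)"
    by (simp add: algebra_simps)
  then show ?case
    unfolding Suc.IH by (simp add: algebra_simps)
qed

text \<open>Apply q d/dq to \<open>(1 - fps_X ^ k) * fps_geom k = 1\<close>, then multiply by
  \<open>fps_geom k\<close> to isolate the derivative.\<close>

lemma fps_X_deriv_fps_geom: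
  assumes "k > 0"
  shows "fps_X * fps_deriv (fps_geom k) = of_nat k * fps_X ^ k * fps_geom k * fps_geom k"
proof -
  let ?u = "1 - fps_X ^ k :: int fps"
  have "fps_X * fps_deriv (?u * fps_geom k) = 0"
    by (simp add: fps_geom_inverse[OF assms])
  then have "fps_geom k * (fps_X * fps_deriv ?u) + ?u * (fps_X * fps_deriv (fps_geom k)) = 0"
    by (simp only: fps_deriv_mult) (simp only: algebra_simps)
  then have *: "?u * (fps_X * fps_deriv (fps_geom k)) = of_nat k * fps_X ^ k * fps_geom k"
    unfolding fps_X_deriv_one_minus_X_power
    by (simp only: add_eq_0_iff2 mult_minus_left mult_minus_right neg_equal_iff_equal mult_ac)
  have "fps_X * fps_deriv (fps_geom k) = (?u * fps_geom k) * (fps_X * fps_deriv (fps_geom k))"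
    by (simp add: fps_geom_inverse[OF assms])
  also have "\<dots> = (?u * (fps_X * fps_deriv (fps_geom k))) * fps_geom k"
    by (simp only: mult_ac)
  finally show ?thesis
    unfolding * .
qed

definition alt_sign :: "nat \<Rightarrow> int" where
  "alt_sign k = (if odd k then int k else - int k)"

definition alt_lambert :: "nat \<Rightarrow> int fps" where
  "alt_lambert N = (\<Sum>k=1..N. of_int (alt_sign k) * fps_X ^ k * fps_geom k)"

text \<open>The logarithmic derivative turns products into sums: the factor
  \<open>psi_factor n\<close> contributes the Lambert terms for k = 2n+1 and k = 2n+2.\<close>

lemma psi_log_deriv: "fps_X * fps_deriv (psi n) = psi n * alt_lambert (2*n)"
proof (induction n)
  case 0
  show ?case by (simp add: psi_def alt_lambert_def)
next
  case (Suc n)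
  define u g h v :: "int fps" where "u = 1 - fps_X ^ (2*n+2)" and "g = fps_geom (2*n+1)"
    and "h = fps_geom (2*n+2)" and "v = fps_X ^ (2*n+2)"
  have uh: "u * h = 1"
    unfolding u_def h_def by (rule fps_geom_inverse) simp
  have psi: "psi (Suc n) = psi n * (u * g)"
    by (simp add: psi_def psi_factor_def u_def g_def)
  have dg: "fps_X * fps_deriv g = of_nat (2*n+1) * fps_X ^ (2*n+1) * g * g"
    unfolding g_def by (rule fps_X_deriv_fps_geom) simp
  have du: "fps_X * fps_deriv u = - of_nat (2*n+2) * v"
    unfolding u_def v_def by (rule fps_X_deriv_one_minus_X_power)
  have "2 * Suc n = Suc (Suc (2*n))" by simp
  then have lam: "alt_lambert (2 * Suc n) = alt_lambert (2*n)
      + of_nat (2*n+1) * fps_X ^ (2*n+1) * g - of_nat (2*n+2) * v * h"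
    by (simp only: alt_lambert_def g_def h_def v_def) (simp add: alt_sign_def algebra_simps)
  have "fps_X * fps_deriv (psi (Suc n)) = (fps_X * fps_deriv (psi n)) * u * g
      + psi n * (fps_X * fps_deriv u) * g + psi n * u * (fps_X * fps_deriv g)"
    unfolding psi fps_deriv_mult by (simp only: algebra_simps)
  \<comment> \<open>The factor \<open>u * h\<close>, equal to 1, is inserted to let
    \<open>psi (Suc n)\<close> be factored out of the middle term too.\<close>
  also have "\<dots> = psi n * alt_lambert (2*n) * u * g
      - psi n * (of_nat (2*n+2) * v) * (u * h) * g
      + psi n * u * (of_nat (2*n+1) * fps_X ^ (2*n+1) * g * g)"
    unfolding Suc.IH du dg uh
    by (simp only: mult_minus_left mult_minus_right diff_conv_add_uminus mult_1_right mult.assoc)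
  also have "\<dots> = psi (Suc n) * alt_lambert (2 * Suc n)"
    unfolding psi lam by (simp only: algebra_simps)
  finally show ?case .
qed

section \<open>Generating functions of partitions with bounded parts\<close>

definition bounded_partitions :: "nat \<Rightarrow> nat \<Rightarrow> nat list set" where
  "bounded_partitions N n = {xs \<in> int_partitions n. \<forall>x\<in>set xs. x \<le> N}"

definition bounded_gf :: "nat \<Rightarrow> (nat list \<Rightarrow> int) \<Rightarrow> int fps" where
  "bounded_gf N g = Abs_fps (\<lambda>n. \<Sum>xs\<in>bounded_partitions N n. g xs)"

lemma finite_bounded_partitions: "finite (bounded_partitions N n)"
  unfolding bounded_partitions_def using finite_int_partitions by simp

lemma bounded_partitions_eq_int_partitions:
  assumes "n \<le> N"
  shows "bounded_partitions N n = int_partitions n"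
  using assms member_le_sum_list by (fastforce simp: bounded_partitions_def int_partitions_def)

lemma bounded_partitions_0:
  "bounded_partitions 0 n = (if n = 0 then {[]} else {})"
proof -
  have "xs \<in> bounded_partitions 0 n \<longleftrightarrow> n = 0 \<and> xs = []" for xs
    by (cases xs) (auto simp: bounded_partitions_def int_partitions_def)
  then show ?thesis by auto
qed

text \<open>In a non-increasing list a part \<open>Suc N\<close> of maximal size must stand at the
  head; the tail may contain further copies.\<close>

lemma bounded_partitions_Suc:
  "bounded_partitions (Suc N) n = bounded_partitions N n \<union>
     (if Suc N \<le> n then (#) (Suc N) ` bounded_partitions (Suc N) (n - Suc N) else {})"
  (is "?L = ?R")
proof (intro set_eqI)
  fix xs
  show "xs \<in> ?L \<longleftrightarrow> xs \<in> ?R"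
  proof (cases xs)
    case Nil
    then show ?thesis by (auto simp: bounded_partitions_def int_partitions_def)
  next
    case (Cons y ys)
    show ?thesis
    proof (cases "y = Suc N")
      case True
      then show ?thesis
        using Cons by (auto simp: bounded_partitions_def int_partitions_def image_iff)
    next
      case False
      then show ?thesis
        using Cons by (auto simp: bounded_partitions_def int_partitions_def image_iff le_Suc_eq)
    qed
  qed
qed

text \<open>The weight \<open>g\<close> is arbitrary so that the same recurrence serves both the
  plain count and \<open>alt_sum\<close>.\<close>

lemma bounded_gf_Suc:
  "bounded_gf (Suc N) g = bounded_gf N g + fps_X ^ Suc N * bounded_gf (Suc N) (\<lambda>xs. g (Suc N # xs))"
proof (rule fps_ext)
  fix n
  let ?B = "if Suc N \<le> n then (#) (Suc N) ` bounded_partitions (Suc N) (n - Suc N) else {}"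
  have "(\<Sum>xs\<in>bounded_partitions (Suc N) n. g xs)
      = (\<Sum>xs\<in>bounded_partitions N n. g xs) + (\<Sum>xs\<in>?B. g xs)"
    unfolding bounded_partitions_Suc[of N n]
    by (rule sum.union_disjoint) (auto simp: finite_bounded_partitions, auto simp: bounded_partitions_def)
  moreover have "(\<Sum>xs\<in>?B. g xs) = (if Suc N \<le> n then
      \<Sum>xs\<in>bounded_partitions (Suc N) (n - Suc N). g (Suc N # xs) else 0)"
    by (simp add: sum.reindex)
  ultimately show "fps_nth (bounded_gf (Suc N) g) n
      = fps_nth (bounded_gf N g + fps_X ^ Suc N * bounded_gf (Suc N) (\<lambda>xs. g (Suc N # xs))) n"
    unfolding bounded_gf_def by (simp add: fps_X_power_mult_nth del: power_Suc)
qed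

lemma bounded_gf_1: "bounded_gf N (\<lambda>_. 1) = (\<Prod>k=1..N. fps_geom k)"
proof (induction N)
  case 0
  show ?case by (rule fps_ext) (simp add: bounded_gf_def bounded_partitions_0)
next
  case (Suc N)
  then show ?case
    using fps_geom_unique[OF _ bounded_gf_Suc[of N "\<lambda>_. 1"]] by simp
qed

definition alt_sum :: "nat list \<Rightarrow> int" where
  "alt_sum xs = (\<Sum>x\<leftarrow>xs. alt_sign x)"

text \<open>Since \<open>alt_sum\<close> is additive, removing a part \<open>Suc N\<close>
  reproduces the series plus \<open>alt_sign (Suc N)\<close> times the plain count; solving for the
  series yields the next Lambert term.\<close>

lemma bounded_gf_alt_sum:
  "bounded_gf N alt_sum = bounded_gf N (\<lambda>_. 1) * alt_lambert N"
proof (induction N)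
  case 0
  show ?case
    by (rule fps_ext) (simp add: bounded_gf_def bounded_partitions_0 alt_lambert_def alt_sum_def)
next
  case (Suc N)
  let ?C = "bounded_gf (Suc N) (\<lambda>_. 1)" and ?g = "fps_geom (Suc N)"
    and ?a = "of_int (alt_sign (Suc N)) :: int fps"
  have C: "?C = bounded_gf N (\<lambda>_. 1) * ?g"
    by (simp add: bounded_gf_1)
  have shift: "bounded_gf (Suc N) (\<lambda>xs. alt_sum (Suc N # xs)) = ?a * ?C + bounded_gf (Suc N) alt_sum"
    by (rule fps_ext)
       (simp add: bounded_gf_def alt_sum_def sum.distrib fps_of_int[symmetric])
  have "bounded_gf (Suc N) alt_sum
      = (bounded_gf N alt_sum + fps_X ^ Suc N * ?a * ?C) + fps_X ^ Suc N * bounded_gf (Suc N) alt_sum"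
    by (rule trans[OF bounded_gf_Suc]) (simp only: shift distrib_left mult_ac add_ac)
  then have "bounded_gf (Suc N) alt_sum = (bounded_gf N alt_sum + fps_X ^ Suc N * ?a * ?C) * ?g"
    by (rule fps_geom_unique[rotated]) simp
  also have "\<dots> = ?C * (alt_lambert N + ?a * fps_X ^ Suc N * ?g)"
    unfolding Suc.IH C by (simp only: algebra_simps)
  also have "alt_lambert N + ?a * fps_X ^ Suc N * ?g = alt_lambert (Suc N)"
    by (simp add: alt_lambert_def)
  finally show ?case .
qed

text \<open>Each new pair of factors satisfies 1/((1 - q^(2n+1))(1 - q^(2n+2))) =
  \<open>psi_factor n\<close> / (1 - q^(2n+2))^2.\<close>

lemma prod_fps_geom_eq_psi:
  "(\<Prod>k=1..2*n. fps_geom k) = psi n * (\<Prod>k<n. fps_geom (2*k+2)) * (\<Prod>k<n. fps_geom (2*k+2))"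
proof (induction n)
  case 0
  show ?case by (simp add: psi_def)
next
  case (Suc n)
  define u g h :: "int fps" where "u = 1 - fps_X ^ (2*n+2)" and "g = fps_geom (2*n+1)"
    and "h = fps_geom (2*n+2)"
  have uh: "u * h = 1"
    unfolding u_def h_def by (rule fps_geom_inverse) simp
  have psi: "psi (Suc n) = psi n * (u * g)"
    by (simp add: psi_def psi_factor_def u_def g_def)
  let ?E = "\<Prod>k<n. fps_geom (2*k+2)"
  have "2 * Suc n = Suc (Suc (2*n))" by simp
  then have "(\<Prod>k=1..2*Suc n. fps_geom k) = (\<Prod>k=1..2*n. fps_geom k) * g * h"
    by (simp only: g_def h_def) simp
  also have "\<dots> = psi n * ?E * ?E * g * h * (u * h)"
    unfolding Suc.IH uh by simp
  also have "\<dots> = psi (Suc n) * (?E * h) * (?E * h)"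
    unfolding psi by (simp only: mult_ac)
  finally show ?case
    by (simp add: h_def)
qed

lemma some_diff_eq_alt_sum: "some_diff n = (\<Sum>xs\<in>int_partitions n. alt_sum xs)"
proof -
  have "(\<Sum>x\<leftarrow>filter odd xs. int x) - (\<Sum>x\<leftarrow>filter even xs. int x) = alt_sum xs" for xs
    by (induction xs) (auto simp: alt_sum_def alt_sign_def)
  then show ?thesis
    by (simp add: some_diff_def sum_subtractf[symmetric])
qed

theorem theorem3p8:
  fixes n :: nat
  assumes "n \<ge> 2"
  shows "some_diff n \<ge> some_diff (n - 2)"
proof -
  let ?W = "bounded_gf (2*n) alt_sum"
  let ?E = "\<Prod>k<n. fps_geom (2*k+2)"
  let ?E' = "\<Prod>k\<in>{1..<n}. fps_geom (2*k+2)"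
  let ?D = "fps_X * fps_deriv (psi n)"
  \<comment> \<open>Parts up to \<open>2*n\<close> suit the n factors of \<open>psi n\<close> and
    cover every partition of \<open>m\<close>.\<close>
  have W: "fps_nth ?W m = some_diff m" if "m \<le> n" for m
    using that by (simp add: bounded_gf_def some_diff_eq_alt_sum bounded_partitions_eq_int_partitions)
  \<comment> \<open>The factor k = 0 is 1/(1 - q^2), the one that 1 - q^2 cancels.\<close>
  have E: "?E = fps_geom 2 * ?E'"
    using assms by (simp add: lessThan_atLeast0 prod.atLeast_Suc_lessThan numeral_2_eq_2)
  have "?W = ?D * ?E * ?E"
    unfolding bounded_gf_alt_sum bounded_gf_1 prod_fps_geom_eq_psi psi_log_deriv
    by (simp only: mult_ac)
  then have "(1 - fps_X\<^sup>2) * ?W = ((1 - fps_X\<^sup>2) * fps_geom 2) * (?D * ?E' * ?E)"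
    unfolding E by (simp only: mult_ac)
  also have "\<dots> = ?D * ?E' * ?E"
    by (simp add: fps_geom_inverse)
  finally have eq: "(1 - fps_X\<^sup>2) * ?W = ?D * ?E' * ?E" .
  \<comment> \<open>The operator q d/dq multiplies the coefficient of q^m by m, so signs are
    kept.\<close>
  have "nonneg_upto (2*n) ?D"
    using nonneg_upto_psi[of n] assms by (auto simp: nonneg_upto_def)
  then have "nonneg_upto (2*n) ((1 - fps_X\<^sup>2) * ?W)"
    unfolding eq by (intro nonneg_upto_mult[of _ "_ * _"] nonneg_upto_mult[of _ ?D]
      nonneg_upto_prod nonneg_upto_fps_geom)
  then have "0 \<le> fps_nth ((1 - fps_X\<^sup>2) * ?W) n"
    by (simp add: nonneg_upto_def)
  then show ?thesis
    using assms by (simp add: left_diff_distrib fps_X_power_mult_nth W)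
qed

end
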